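(* The following three identities hold: $$\sum_{n=0}^{\infty}\frac{(-1)^nq^{\binom{n+1}{2}}}{(q^{n+1};q)_{n}}=\sum_{n=0}^{\infty}(-1)^nq^{-10n+21\binom{n+1}{2}}+q^{10}\sum_{n=0}^{\infty}(-1)^nq^{10n+21\binom{n+1}{2}}-q\sum_{n=0}^{\infty}(-1)^nq^{-4n+21\binom{n+1}{2}}-q^5\sum_{n=0}^{\infty}(-1)^nq^{4n+21\binom{n+1}{2}},$$ $$\sum_{n=0}^{\infty}\frac{(-1)^{n+1}q^{\binom{n+1}{2}}}{(q^{n+1};q)_{n+1}}=-\sum_{n=0}^{\infty}(-1)^nq^{-8n+21\binom{n+1}{2}}-q^{8}\sum_{n=0}^{\infty}(-1)^nq^{8n+21\binom{n+1}{2}}-q^2\sum_{n=0}^{\infty}(-1)^nq^{-n+21\binom{n+1}{2}}-q^3\sum_{n=0}^{\infty}(-1)^nq^{n+21\binom{n+1}{2}},$$ $$\sum_{n=0}^{\infty}\frac{(-1)^{n+1}q^{\binom{n+2}{2}}}{(q^{n+1};q)_{n+1}}=-q\sum_{n=0}^{\infty}(-1)^nq^{-5n+21\binom{n+1}{2}}-q^{6}\sum_{n=0}^{\infty}(-1)^nq^{5n+21\binom{n+1}{2}}-q^2\sum_{n=0}^{\infty}(-1)^nq^{-2n+21\binom{n+1}{2}}-q^4\sum_{n=0}^{\infty}(-1)^nq^{2n+21\binom{n+1}{2}}.$$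
   Context: $q$ is a complex number with $0<|q|<1$, and $(x;q)_n=\prod_{i=0}^{n-1}(1-xq^i)$. *)

theory Defs
  imports "HOL-Analysis.Analysis"
begin

definition qpoch :: "complex \<Rightarrow> complex \<Rightarrow> nat \<Rightarrow> complex" where
  "qpoch x q n = (\<Prod>i<n. 1 - x * q ^ i)"

text \<open>
  The facts below show that every series occurring in the theorem converges absolutely and that
  no denominator vanishes, so that neither the default value of a divergent \<open>suminf\<close> nor
  division by zero is involved.
\<close>

lemma summable_power_triangle:
  fixes r c :: real
  assumes "0 \<le> r" "r < 1" "0 \<le> c"
  shows "summable (\<lambda>n. r ^ (Suc n choose 2) * c ^ n)"
proof -
  have "(\<lambda>n. r ^ Suc n * c) \<longlonglongrightarrow> 0 * c"
    using assms by (intro tendsto_mult tendsto_const LIMSEQ_Suc LIMSEQ_power_zero) auto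
  hence "\<forall>\<^sub>F n in sequentially. r ^ Suc n * c < 1 / 2"
    by (rule order_tendstoD) simp
  then obtain N where N: "\<And>n. n \<ge> N \<Longrightarrow> r ^ Suc n * c < 1 / 2"
    unfolding eventually_sequentially by blast
  show ?thesis
  proof (rule summable_ratio_test[of "1/2" N])
    fix n assume "n \<ge> N"
    have "Suc (Suc n) choose 2 = (Suc n choose 2) + Suc n"
      by (simp add: numeral_2_eq_2)
    hence eq: "r ^ (Suc (Suc n) choose 2) * c ^ Suc n
                 = (r ^ Suc n * c) * (r ^ (Suc n choose 2) * c ^ n)"
      by (simp add: power_add)
    have "(r ^ Suc n * c) * (r ^ (Suc n choose 2) * c ^ n) \<le> 1 / 2 * (r ^ (Suc n choose 2) * c ^ n)"
      using N[OF \<open>n \<ge> N\<close>] assms by (intro mult_right_mono) auto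
    thus "norm (r ^ (Suc (Suc n) choose 2) * c ^ Suc n)
            \<le> 1 / 2 * norm (r ^ (Suc n choose 2) * c ^ n)"
      unfolding eq using assms by (simp add: abs_mult)
  qed simp
qed

lemma norm_qpoch_ge:
  assumes "norm q < 1"
  shows "norm (qpoch (q ^ Suc m) q n) \<ge> (1 - norm q) ^ n"
proof -
  have "(\<Prod>i<n. 1 - norm q) \<le> (\<Prod>i<n. norm (1 - q ^ Suc m * q ^ i))"
  proof (rule prod_mono)
    fix i
    have "norm (q ^ Suc m * q ^ i) = norm q ^ Suc (m + i)"
      by (simp add: norm_mult norm_power power_add)
    also have "\<dots> \<le> norm q ^ 1"
      using assms by (intro power_decreasing) auto
    finally have "norm (q ^ Suc m * q ^ i) \<le> norm q" by simp
    moreover have "norm (1 :: complex) - norm (q ^ Suc m * q ^ i) \<le> norm (1 - q ^ Suc m * q ^ i)"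
      by (rule norm_triangle_ineq2)
    ultimately show "0 \<le> 1 - norm q \<and> 1 - norm q \<le> norm (1 - q ^ Suc m * q ^ i)"
      using assms by simp
  qed
  thus ?thesis by (simp add: qpoch_def prod_norm)
qed

lemma qpoch_nonzero:
  assumes "norm q < 1"
  shows "qpoch (q ^ Suc m) q n \<noteq> 0"
proof -
  have "0 < (1 - norm q) ^ n" using assms by simp
  also have "\<dots> \<le> norm (qpoch (q ^ Suc m) q n)" by (rule norm_qpoch_ge[OF assms])
  finally show ?thesis by auto
qed

lemma summable_qpoch_series:
  fixes q :: complex
  assumes "norm q < 1"
  shows "summable (\<lambda>n. norm ((-1) ^ (n + s) * q ^ ((n + 1 + d) choose 2)
                              / qpoch (q ^ (n + 1)) q (n + j)))"
proof (rule summable_comparison_test')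
  define r where "r = norm q"
  have r: "0 \<le> r" "r < 1" using assms by (auto simp: r_def)
  show "summable (\<lambda>n. 1 / (1 - r) ^ j * (r ^ (Suc n choose 2) * (1 / (1 - r)) ^ n))"
    using r by (intro summable_mult summable_power_triangle) auto
  fix n :: nat
  have "Suc n choose 2 \<le> (n + 1 + d) choose 2"
    by (intro binomial_right_mono) auto
  hence "r ^ ((n + 1 + d) choose 2) \<le> r ^ (Suc n choose 2)"
    using r by (intro power_decreasing) auto
  moreover have "(1 - r) ^ (n + j) \<le> norm (qpoch (q ^ (n + 1)) q (n + j))"
    using norm_qpoch_ge[OF assms, where m = n and n = "n + j"] by (simp add: r_def)
  ultimately have "r ^ ((n + 1 + d) choose 2) / norm (qpoch (q ^ (n + 1)) q (n + j))
                     \<le> r ^ (Suc n choose 2) / (1 - r) ^ (n + j)"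
    using r by (intro frac_le) auto
  thus "norm (norm ((-1) ^ (n + s) * q ^ ((n + 1 + d) choose 2) / qpoch (q ^ (n + 1)) q (n + j)))
          \<le> 1 / (1 - r) ^ j * (r ^ (Suc n choose 2) * (1 / (1 - r)) ^ n)"
    by (simp add: norm_mult norm_divide norm_power r_def power_add power_divide field_simps)
qed

lemma summable_theta_series:
  fixes q :: complex and a :: int
  assumes "q \<noteq> 0" "norm q < 1"
  shows "summable (\<lambda>n. norm ((-1) ^ n * q powi (a * int n + 21 * int ((n + 1) choose 2))))"
proof -
  have "norm ((-1) ^ n * q powi (a * int n + 21 * int ((n + 1) choose 2)))
          = (norm q ^ 21) ^ (Suc n choose 2) * (norm q powi a) ^ n" for n
  proof -
    have "norm q powi (21 * int (Suc n choose 2)) = (norm q ^ 21) ^ (Suc n choose 2)"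
      by (metis power_int_mult power_int_numeral power_int_of_nat)
    moreover have "norm q powi (a * int n) = (norm q powi a) ^ n"
      by (simp add: power_int_mult)
    ultimately show ?thesis
      using assms by (simp add: norm_mult norm_power norm_power_int power_int_add)
  qed
  moreover have "summable (\<lambda>n. (norm q ^ 21) ^ (Suc n choose 2) * (norm q powi a) ^ n)"
    using assms by (intro summable_power_triangle) (auto simp: power_less_one_iff)
  ultimately show ?thesis by simp
qed

end

theory Submission
  imports Defs
begin

text \<open>
  Write \<open>(q)\<^sub>n\<close> for \<open>qpoch q q n\<close>. If
  \<open>\<beta>\<^sub>n = (\<Sum>r\<le>n. \<alpha>\<^sub>r / ((q)\<^bsub>n-r\<^esub> (q)\<^bsub>n+r+1\<^esub>))\<close>, a limiting case of the Bailey lemma equates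
  the sum of \<open>(-1)\<^sup>n q\<^bsup>n(n+1)/2\<^esup> (q)\<^sub>n \<beta>\<^sub>n\<close> with that of \<open>(-1)\<^sup>r q\<^bsup>r(r+1)/2\<^esup> \<alpha>\<^sub>r\<close>. Up to
  elementary factors, the three left-hand sides belong to \<open>\<beta>\<^sub>n = 1 / (q)\<^bsub>2n\<^esub>\<close>, \<open>1 / (q)\<^bsub>2n+1\<^esub>\<close> and
  \<open>q\<^sup>n / (q)\<^bsub>2n+1\<^esub>\<close>. The corresponding \<open>\<alpha>\<^sub>r\<close> depend on \<open>r\<close> modulo 3 and have exponents about
  \<open>2r\<^sup>2/3\<close>, so that the total exponent has leading term \<open>21k\<^sup>2/2\<close> at \<open>r = 3k\<close>. That these
  \<open>\<alpha>\<^sub>r\<close> yield these \<open>\<beta>\<^sub>n\<close> is an evaluation of finite sums of Gaussian binomial coefficients: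
  under a suitably chosen \<open>q\<close>-Pascal rule such a sum splits into two, one of which usually is
  antisymmetric under reflection and vanishes.
\<close>

section \<open>Elementary facts about q-shifted factorials\<close>

lemma qpoch_0 [simp]: "qpoch x q 0 = 1"
  by (simp add: qpoch_def)

lemma qpoch_Suc: "qpoch x q (Suc n) = qpoch x q n * (1 - x * q ^ n)"
  by (simp add: qpoch_def)

lemma qpoch_add: "qpoch q q (n + k) = qpoch q q n * qpoch (q ^ (n + 1)) q k"
  by (induction k) (simp_all add: qpoch_Suc power_add algebra_simps)

lemma qpoch_self_nonzero:
  assumes "norm q < 1"
  shows "qpoch q q n \<noteq> 0"
  using qpoch_nonzero[OF assms, of 0] by simp

lemma one_minus_power_nonzero:
  fixes q :: complex
  assumes "norm q < 1"
  shows "1 - q * q ^ n \<noteq> 0"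
  using qpoch_self_nonzero[OF assms, of "Suc n"] by (simp add: qpoch_Suc)

section \<open>Sums weighted by Gaussian binomial coefficients\<close>

definition qbinom :: "complex \<Rightarrow> nat \<Rightarrow> nat \<Rightarrow> complex" where
  "qbinom q n k = qpoch q q n / (qpoch q q k * qpoch q q (n - k))"

lemma qbinom_0 [simp]: "norm q < 1 \<Longrightarrow> qbinom q n 0 = 1"
  by (simp add: qbinom_def qpoch_self_nonzero)

lemma qbinom_self [simp]: "norm q < 1 \<Longrightarrow> qbinom q n n = 1"
  by (simp add: qbinom_def qpoch_self_nonzero)

lemma qbinom_symmetric: "k \<le> n \<Longrightarrow> qbinom q n (n - k) = qbinom q n k"
  by (simp add: qbinom_def mult.commute)

text \<open>With n = k + j + 1 this rests on 1 - q^(n+1) = (1 - q^(j+1)) + q^(j+1) (1 - q^(k+1)).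
  The case k = n is excluded because subtraction truncates: \<open>qbinom q n (Suc n)\<close> is 1 /
  (1 - q^(n+1)) rather than 0.\<close>

lemma qbinom_Suc_Suc:
  assumes "norm q < 1" "k < n"
  shows "qbinom q (Suc n) (Suc k) = qbinom q n (Suc k) + q ^ (n - k) * qbinom q n k"
proof -
  obtain j where n: "n = Suc (k + j)"
    using assms(2) less_imp_Suc_add by blast
  have [simp]: "qpoch q q i \<noteq> 0" for i
    using assms(1) by (rule qpoch_self_nonzero)
  define a b where "a = 1 - q * q ^ k" and "b = 1 - q * q ^ j"
  have ab: "a \<noteq> 0" "b \<noteq> 0"
    unfolding a_def b_def by (rule one_minus_power_nonzero[OF assms(1)])+
  have eq: "1 - q * q ^ n = b + q * q ^ j * a"
    by (simp add: a_def b_def n algebra_simps power_add)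
  have d: "Suc n - Suc k = Suc j" "n - Suc k = j" "n - k = Suc j"
    by (simp_all add: n)
  show ?thesis
    unfolding qbinom_def d qpoch_Suc eq using ab
    by (simp add: field_simps flip: a_def b_def)
qed

definition qsum :: "complex \<Rightarrow> nat \<Rightarrow> (nat \<Rightarrow> complex) \<Rightarrow> complex" where
  "qsum q n f = (\<Sum>i\<le>n. f i * qbinom q n i)"

lemma qsum_cong: "(\<And>i. i \<le> n \<Longrightarrow> f i = g i) \<Longrightarrow> qsum q n f = qsum q n g"
  by (simp add: qsum_def)

lemma qsum_cmult: "qsum q n (\<lambda>i. a * f i) = a * qsum q n f"
  by (simp add: qsum_def sum_distrib_left mult.assoc)

lemma qsum_reflect: "qsum q n (\<lambda>i. f (n - i)) = qsum q n f"
  unfolding qsum_def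
  by (rule sum.reindex_bij_witness[of _ "\<lambda>i. n - i" "\<lambda>i. n - i"])
     (auto simp: qbinom_symmetric)

text \<open>Reversing the index preserves the Gaussian binomial coefficients, so the sum equals its
  own negative. Every vanishing \<open>qsum\<close> below comes from this.\<close>

lemma qsum_antisymmetric:
  assumes "\<And>i. i \<le> n \<Longrightarrow> f (n - i) = - f i"
  shows "qsum q n f = 0"
proof -
  have "qsum q n f = qsum q n (\<lambda>i. (-1) * f i)"
    using assms by (subst qsum_reflect[symmetric]) (intro qsum_cong, simp)
  thus ?thesis by (subst (asm) qsum_cmult) simp
qed

lemma qsum_Suc:
  assumes "norm q < 1"
  shows "qsum q (Suc n) f = qsum q n f + qsum q n (\<lambda>i. q ^ (n - i) * f (Suc i))"
proof -
  have "qsum q (Suc n) f = f 0 + (\<Sum>i\<le>n. f (Suc i) * qbinom q (Suc n) (Suc i))"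
    using assms by (simp add: qsum_def sum.atMost_Suc_shift del: sum.atMost_Suc)
  also have "(\<Sum>i\<le>n. f (Suc i) * qbinom q (Suc n) (Suc i)) =
      (\<Sum>i\<le>n. (if i < n then f (Suc i) * qbinom q n (Suc i) else 0)
              + q ^ (n - i) * f (Suc i) * qbinom q n i)"
    using assms by (intro sum.cong) (auto simp: qbinom_Suc_Suc algebra_simps)
  also have "\<dots> = (\<Sum>i\<le>n. if i < n then f (Suc i) * qbinom q n (Suc i) else 0)
                  + qsum q n (\<lambda>i. q ^ (n - i) * f (Suc i))"
    by (simp add: sum.distrib qsum_def)
  also have "(\<Sum>i\<le>n. if i < n then f (Suc i) * qbinom q n (Suc i) else 0) =
             (\<Sum>i<n. f (Suc i) * qbinom q n (Suc i))"
    by (simp add: lessThan_Suc_atMost[symmetric])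
  also have "f 0 + ((\<Sum>i<n. f (Suc i) * qbinom q n (Suc i))
                  + qsum q n (\<lambda>i. q ^ (n - i) * f (Suc i)))
             = qsum q n f + qsum q n (\<lambda>i. q ^ (n - i) * f (Suc i))"
    using assms by (simp add: qsum_def sum.atMost_shift[of _ n])
  finally show ?thesis .
qed

text \<open>The other q-Pascal rule in summed form, obtained from the first by reflecting before and
  after.\<close>

lemma qsum_Suc':
  assumes "norm q < 1"
  shows "qsum q (Suc n) f = qsum q n (\<lambda>i. q ^ i * f i) + qsum q n (\<lambda>i. f (Suc i))"
proof -
  have "qsum q (Suc n) f = qsum q (Suc n) (\<lambda>i. f (Suc n - i))"
    by (rule qsum_reflect[symmetric])
  also have "\<dots> = qsum q n (\<lambda>i. f (Suc n - i)) + qsum q n (\<lambda>i. q ^ (n - i) * f (n - i))"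
    using assms by (simp add: qsum_Suc)
  also have "qsum q n (\<lambda>i. f (Suc n - i)) = qsum q n (\<lambda>i. f (Suc (n - i)))"
    by (intro qsum_cong) (simp add: Suc_diff_le)
  also have "\<dots> = qsum q n (\<lambda>i. f (Suc i))"
    by (rule qsum_reflect)
  also have "qsum q n (\<lambda>i. q ^ (n - i) * f (n - i)) = qsum q n (\<lambda>i. q ^ i * f i)"
    by (rule qsum_reflect[of _ _ "\<lambda>i. q ^ i * f i"])
  finally show ?thesis by simp
qed

section \<open>Evaluation of the finite sums\<close>

text \<open>The nonprincipal Dirichlet character modulo 3, evaluated at r + 1. Its oddness turns
  into antisymmetry under r -> 1 - r.\<close>

definition chi3 :: "int \<Rightarrow> complex" where
  "chi3 r = (if r mod 3 = 0 then 1 else if r mod 3 = 1 then -1 else 0)"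

lemma chi3_reflect: "chi3 (1 - r) = - chi3 r"
proof -
  have "r mod 3 = 0 \<or> r mod 3 = 1 \<or> r mod 3 = 2" by presburger
  moreover have "(1 - r) mod 3 = (1 - r mod 3) mod 3" by (simp add: mod_diff_right_eq)
  ultimately show ?thesis by (auto simp: chi3_def)
qed

lemma chi3_minus_minus: "chi3 (- r - 1) = - chi3 (r - 1)"
proof -
  have "(r + 2) mod 3 = (r - 1) mod 3" by presburger
  hence "chi3 (r + 2) = chi3 (r - 1)" by (simp add: chi3_def)
  moreover have "- r - 1 = 1 - (r + 2)" by simp
  ultimately show ?thesis by (simp only: chi3_reflect)
qed

text \<open>
  With \<open>t\<close> a cube root of \<open>q\<close> this is \<open>chi3 r * q powi ((2 * r\<^sup>2 + b * r) / 3)\<close>; for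
  \<open>b = 1\<close> and \<open>b = 4\<close> that exponent is an integer wherever \<open>chi3 r\<close> does not vanish.
\<close>

definition term3 :: "complex \<Rightarrow> int \<Rightarrow> int \<Rightarrow> complex" where
  "term3 t b r = chi3 r * t powi (2 * r ^ 2 + b * r)"

context
  fixes t :: complex
  assumes t0: "t \<noteq> 0" and t1: "norm t < 1"
begin

lemma norm_cube: "norm (t ^ 3) < 1"
  using t1 by (simp add: norm_power power_less_one_iff)

lemma cube_power_times: "(t ^ 3) ^ i * (a * t powi e) = a * t powi (3 * int i + e)"
proof -
  have "(t ^ 3) ^ i = t powi (3 * int i)"
    by (simp add: power_int_mult)
  thus ?thesis using t0 by (simp add: power_int_add)
qed

text \<open>Of the two sums from \<open>qsum_Suc\<close>, the one carrying the extra power of q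
  vanishes: in s = n - i its exponent of t is 3n + 1 + 2s^2, even in s, while
  \<open>chi3 (s - 1)\<close> is odd in s.\<close>

lemma qsum_odd_eq_even:
  "qsum (t ^ 3) (Suc (2 * n)) (\<lambda>i. term3 t 1 (int n - int i)) =
   qsum (t ^ 3) (2 * n) (\<lambda>i. term3 t 1 (int n - int i))"
proof -
  have "qsum (t ^ 3) (2 * n) (\<lambda>i. (t ^ 3) ^ (2 * n - i) * term3 t 1 (int n - int (Suc i))) = 0"
  proof (rule qsum_antisymmetric)
    fix i assume i: "i \<le> 2 * n"
    define s where "s = int n - int i"
    have "(t ^ 3) ^ (2 * n - i) * term3 t 1 (int n - int (Suc i))
          = chi3 (s - 1) * t powi (3 * int n + 1 + 2 * s ^ 2)"
      using i unfolding term3_def cube_power_times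
      by (simp add: s_def of_nat_diff algebra_simps power2_eq_square)
    moreover have "(t ^ 3) ^ (2 * n - (2 * n - i)) * term3 t 1 (int n - int (Suc (2 * n - i)))
          = chi3 (- s - 1) * t powi (3 * int n + 1 + 2 * s ^ 2)"
      using i unfolding term3_def cube_power_times
      by (simp add: s_def of_nat_diff algebra_simps power2_eq_square)
    ultimately show "(t ^ 3) ^ (2 * n - (2 * n - i)) * term3 t 1 (int n - int (Suc (2 * n - i)))
          = - ((t ^ 3) ^ (2 * n - i) * term3 t 1 (int n - int (Suc i)))"
      by (simp add: chi3_minus_minus)
  qed
  thus ?thesis by (subst qsum_Suc[OF norm_cube]) simp
qed

text \<open>Reversing i sends s = n + 1 - i to 1 - s, which fixes 2s^2 - 2s and flips the sign of
  \<open>chi3 s\<close>.\<close>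

lemma qsum_term3_reflect_eq_0:
  "qsum q (Suc (2 * n)) (\<lambda>i. term3 t (-2) (int n + 1 - int i)) = 0"
proof (rule qsum_antisymmetric)
  fix i assume i: "i \<le> Suc (2 * n)"
  define s where "s = int n + 1 - int i"
  have s': "int n + 1 - int (Suc (2 * n) - i) = 1 - s"
    using i by (simp add: s_def of_nat_diff)
  have "2 * (1 - s)\<^sup>2 + - 2 * (1 - s) = 2 * s\<^sup>2 + - 2 * s"
    by (simp add: power2_eq_square algebra_simps)
  thus "term3 t (-2) (int n + 1 - int (Suc (2 * n) - i)) = - term3 t (-2) (int n + 1 - int i)"
    unfolding s' term3_def chi3_reflect s_def[symmetric] by (simp only: mult_minus_left)
qed

text \<open>Powers of q produced by \<open>qsum_Suc'\<close> are absorbed by lowering b by 3. This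
  links the values 4, 1 and -2 of b.\<close>

lemma cube_power_times_term3:
  "(t ^ 3) ^ i * term3 t b (m - int i) = t powi (3 * m) * term3 t (b - 3) (m - int i)"
proof -
  define s where "s = m - int i"
  have "(t ^ 3) ^ i * term3 t b s = chi3 s * t powi (3 * int i + (2 * s\<^sup>2 + b * s))"
    unfolding term3_def cube_power_times ..
  also have "3 * int i + (2 * s\<^sup>2 + b * s) = 3 * m + (2 * s\<^sup>2 + (b - 3) * s)"
    by (simp add: s_def algebra_simps)
  finally show ?thesis
    unfolding s_def[symmetric] using t0 by (simp add: term3_def power_int_add)
qed

text \<open>In \<open>qsum_Suc'\<close> the sum with the factor q^i becomes one with b = -2 and
  vanishes; the index shift in the other lowers the centre from n + 1 to n.\<close>

lemma qsum_even_Suc: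
  "qsum (t ^ 3) (2 * Suc n) (\<lambda>i. term3 t 1 (int (Suc n) - int i)) =
   qsum (t ^ 3) (Suc (2 * n)) (\<lambda>i. term3 t 1 (int n - int i))"
proof -
  have "qsum (t ^ 3) (Suc (2 * n)) (\<lambda>i. (t ^ 3) ^ i * term3 t 1 (int (Suc n) - int i)) = 0"
    unfolding cube_power_times_term3
    using qsum_term3_reflect_eq_0[of "t ^ 3" n] by (simp add: qsum_cmult add.commute)
  thus ?thesis using qsum_Suc'[OF norm_cube, of "Suc (2 * n)"] by simp
qed

text \<open>The value never changes from one length to the next, so it is the single term at n =
  0.\<close>

lemma qsum_even: "qsum (t ^ 3) (2 * n) (\<lambda>i. term3 t 1 (int n - int i)) = 1"
proof (induction n)
  case 0
  show ?case using norm_cube by (simp add: qsum_def term3_def chi3_def)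
next
  case (Suc n)
  thus ?case by (simp only: qsum_even_Suc qsum_odd_eq_even)
qed

lemma qsum_odd: "qsum (t ^ 3) (Suc (2 * n)) (\<lambda>i. term3 t 1 (int n - int i)) = 1"
  by (simp only: qsum_odd_eq_even qsum_even)

text \<open>By \<open>qsum_Suc'\<close>: the shifted sum has exponent 2s^2 - 2 and is antisymmetric
  in s = n - i, and the other one reduces to q^n times the even sum with b = 1.\<close>

lemma qsum_odd_4:
  "qsum (t ^ 3) (Suc (2 * n)) (\<lambda>i. term3 t 4 (int n - int i)) = (t ^ 3) ^ n"
proof -
  have "qsum (t ^ 3) (2 * n) (\<lambda>i. term3 t 4 (int n - int (Suc i))) = 0"
  proof (rule qsum_antisymmetric)
    fix i assume i: "i \<le> 2 * n"
    define s where "s = int n - int i"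
    have e: "int n - int (Suc i) = s - 1" "int n - int (Suc (2 * n - i)) = - s - 1"
      using i by (simp_all add: s_def of_nat_diff)
    have "2 * (s - 1)\<^sup>2 + 4 * (s - 1) = 2 * (- s - 1)\<^sup>2 + 4 * (- s - 1)"
      by (simp add: power2_eq_square algebra_simps)
    thus "term3 t 4 (int n - int (Suc (2 * n - i))) = - term3 t 4 (int n - int (Suc i))"
      unfolding e term3_def chi3_minus_minus by (simp only: mult_minus_left)
  qed
  moreover have "qsum (t ^ 3) (2 * n) (\<lambda>i. (t ^ 3) ^ i * term3 t 4 (int n - int i)) = t powi (3 * int n)"
    unfolding cube_power_times_term3 by (simp add: qsum_cmult qsum_even)
  moreover have "t powi (3 * int n) = (t ^ 3) ^ n"
    by (simp add: power_int_mult)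
  ultimately show ?thesis by (subst qsum_Suc'[OF norm_cube]) simp
qed

text \<open>For n = m + 1, \<open>qsum_Suc'\<close> gives one sum that vanishes by
  \<open>qsum_term3_reflect_eq_0\<close>. Reflecting the other turns s into 1 - u with u = m - i,
  and the exponent becomes 3n + 2u^2 + u, so the odd sum with b = 1 appears with a factor
  -q^n.\<close>

lemma qsum_even_minus_2:
  "qsum (t ^ 3) (2 * n) (\<lambda>i. term3 t (-2) (int n + 1 - int i)) = - ((t ^ 3) ^ n)"
proof (cases n)
  case 0
  thus ?thesis using norm_cube by (simp add: qsum_def term3_def chi3_def)
next
  case (Suc m)
  have "qsum (t ^ 3) (Suc (2 * m)) (\<lambda>i. (t ^ 3) ^ i * term3 t (-2) (int m + 2 - int i)) =
        qsum (t ^ 3) (Suc (2 * m)) (\<lambda>i. (t ^ 3) ^ (Suc (2 * m) - i) *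
           term3 t (-2) (int m + 2 - int (Suc (2 * m) - i)))"
    by (rule qsum_reflect[symmetric])
  also have "\<dots> = qsum (t ^ 3) (Suc (2 * m)) (\<lambda>i. - ((t ^ 3) ^ n) * term3 t 1 (int m - int i))"
  proof (rule qsum_cong)
    fix i assume i: "i \<le> Suc (2 * m)"
    define u where "u = int m - int i"
    have e: "int m + 2 - int (Suc (2 * m) - i) = 1 - u"
            "int (Suc (2 * m) - i) = int m + 1 + u"
      using i by (simp_all add: u_def of_nat_diff)
    have "3 * (int m + 1 + u) + (2 * (1 - u)\<^sup>2 + - 2 * (1 - u)) = 3 * int n + (2 * u\<^sup>2 + 1 * u)"
      by (simp add: power2_eq_square algebra_simps Suc)
    thus "(t ^ 3) ^ (Suc (2 * m) - i) * term3 t (-2) (int m + 2 - int (Suc (2 * m) - i))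
          = - ((t ^ 3) ^ n) * term3 t 1 (int m - int i)"
      unfolding e(1) term3_def u_def[symmetric]
      by (simp only: cube_power_times e(2) mult_minus_left mult_minus_right chi3_reflect)
  qed
  also have "\<dots> = - ((t ^ 3) ^ n)"
    by (simp only: qsum_cmult qsum_odd mult_1_right)
  finally have 1: "qsum (t ^ 3) (Suc (2 * m)) (\<lambda>i. (t ^ 3) ^ i * term3 t (-2) (int n + 1 - int i))
                   = - ((t ^ 3) ^ n)"
    by (simp add: Suc add.commute)
  have 2: "qsum (t ^ 3) (Suc (2 * m)) (\<lambda>i. term3 t (-2) (int n + 1 - int (Suc i))) = 0"
  proof -
    have "int n + 1 - int (Suc i) = int m + 1 - int i" for i by (simp add: Suc)
    thus ?thesis by (simp only: qsum_term3_reflect_eq_0)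
  qed
  have "2 * n = Suc (Suc (2 * m))" by (simp add: Suc)
  thus ?thesis by (simp only: qsum_Suc'[OF norm_cube, of "Suc (2 * m)"] 1 2 add_0_right)
qed

text \<open>The value 1 - q^(2n+1) is the last factor of
  \<open>qpoch (q ^ (n + 1)) q (n + 1)\<close>; cancelling it yields the shorter denominator of the
  first series.\<close>

lemma qsum_odd_shifted:
  "qsum (t ^ 3) (Suc (2 * n)) (\<lambda>i. term3 t 1 (int n + 1 - int i)) = 1 - (t ^ 3) ^ Suc (2 * n)"
proof -
  have "t powi (3 * (int n + 1)) = (t ^ 3) ^ Suc n"
    by (metis of_nat_Suc add.commute power_int_mult power_int_numeral power_int_of_nat)
  moreover have "(t ^ 3) ^ Suc n * (t ^ 3) ^ n = (t ^ 3) ^ Suc (2 * n)"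
    by (simp add: mult_2 power_add)
  moreover have "(1 :: int) - 3 = - 2" by simp
  ultimately have "qsum (t ^ 3) (2 * n) (\<lambda>i. (t ^ 3) ^ i * term3 t 1 (int n + 1 - int i))
      = - ((t ^ 3) ^ Suc (2 * n))"
    by (simp only: cube_power_times_term3 qsum_cmult qsum_even_minus_2 mult_minus_right)
  moreover have "int n + 1 - int (Suc i) = int n - int i" for i by simp
  ultimately show ?thesis
    by (simp only: qsum_Suc'[OF norm_cube, of "2 * n"] qsum_even) simp
qed

end

section \<open>A limiting case of the Bailey lemma\<close>

context
  fixes q :: complex
  assumes q1: "norm q < 1"
begin

lemma qpoch_self_neq_0 [simp]: "qpoch q q n \<noteq> 0"
  by (rule qpoch_self_nonzero[OF q1])

text \<open>
  The conjugate Bailey pair relative to \<open>a = q\<close> with \<open>\<rho>\<^sub>1 = q\<close> and \<open>\<rho>\<^sub>2 \<longrightarrow> \<infinity>\<close>.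
\<close>

definition conj_term :: "nat \<Rightarrow> nat \<Rightarrow> complex" where
  "conj_term r n = (if r \<le> n then (-1) ^ n * q ^ (Suc n choose 2) * qpoch q q n
                      / (qpoch q q (n - r) * qpoch q q (n + r + 1)) else 0)"

text \<open>A majorant of \<open>conj_term r n\<close> uniform in r: the numerator factorial is at
  most 2^n in norm, and the two in the denominator together have 2n + 1 factors for every r, each at
  least 1 - |q|.\<close>

definition conj_bound :: "nat \<Rightarrow> real" where
  "conj_bound n = 1 / (1 - norm q) * (norm q ^ (Suc n choose 2) * (2 / (1 - norm q) ^ 2) ^ n)"

lemma conj_bound_nonneg: "0 \<le> conj_bound n"
  using q1 by (simp add: conj_bound_def)

lemma summable_conj_bound: "summable conj_bound"
  unfolding conj_bound_def using q1 by (intro summable_mult summable_power_triangle) auto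

lemma norm_qpoch_self_le: "norm (qpoch q q n) \<le> 2 ^ n"
proof -
  have "norm (1 - q * q ^ i) \<le> 2" for i
  proof -
    have "norm (q * q ^ i) \<le> 1"
      using q1 by (metis norm_power power_Suc power_le_one norm_ge_zero less_imp_le)
    thus ?thesis using norm_triangle_ineq4[of 1 "q * q ^ i"] by simp
  qed
  hence "(\<Prod>i<n. norm (1 - q * q ^ i)) \<le> (\<Prod>i<n. 2)"
    by (intro prod_mono) auto
  thus ?thesis by (simp add: qpoch_def prod_norm)
qed

lemma norm_conj_term_le: "norm (conj_term r n) \<le> conj_bound n"
proof (cases "r \<le> n")
  case True
  define d where "d = 1 - norm q"
  have d: "d > 0" using q1 by (simp add: d_def)
  have lower: "d ^ k \<le> norm (qpoch q q k)" for k
    using norm_qpoch_ge[OF q1, of k 0] by (simp add: d_def)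
  have "d ^ (n - r) * d ^ (n + r + 1) = d * (d ^ 2) ^ n"
    using True by (simp add: power_add[symmetric] power_mult[symmetric] mult_2 flip: power_Suc)
  moreover have "d ^ (n - r) * d ^ (n + r + 1) \<le> norm (qpoch q q (n - r)) * norm (qpoch q q (n + r + 1))"
    using d by (intro mult_mono lower) auto
  moreover have "norm q ^ (Suc n choose 2) * norm (qpoch q q n) \<le> norm q ^ (Suc n choose 2) * 2 ^ n"
    by (intro mult_left_mono norm_qpoch_self_le) auto
  ultimately have "norm q ^ (Suc n choose 2) * norm (qpoch q q n)
          / (norm (qpoch q q (n - r)) * norm (qpoch q q (n + r + 1)))
        \<le> norm q ^ (Suc n choose 2) * 2 ^ n / (d * (d ^ 2) ^ n)"
    using d by (intro frac_le) (auto simp del: power_Suc)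
  thus ?thesis
    using True by (simp add: conj_term_def conj_bound_def norm_mult norm_divide norm_power
        power_divide flip: d_def)
qed (simp add: conj_term_def conj_bound_nonneg)

section \<open>Evaluation of the conjugate sum by telescoping\<close>

definition shifted_term :: "nat \<Rightarrow> nat \<Rightarrow> complex" where
  "shifted_term r m = (-1) ^ m * q ^ ((Suc m choose 2) + r * m) * qpoch q q (r + m)
                        / (qpoch q q m * qpoch q q (2 * r + 1 + m))"

text \<open>Starting the summation at n = r splits off the expected value of the sum; what remains
  is normalised to have sum 1 for every r.\<close>

lemma conj_term_shift:
  "conj_term r (m + r) = (-1) ^ r * q ^ (Suc r choose 2) * shifted_term r m"
proof -
  have "Suc (m + r) choose 2 = (Suc m choose 2) + r * m + (Suc r choose 2)"
    by (induction m) (simp_all add: numeral_2_eq_2)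
  moreover have "m + r + r + 1 = 2 * r + 1 + m" by simp
  ultimately show ?thesis
    unfolding conj_term_def shifted_term_def
    by (simp only: power_add le_add2 if_True add_diff_cancel_right' add.commute[of r m] mult_ac
        times_divide_eq_right times_divide_eq_left)
qed

lemma summable_conj_term: "summable (conj_term r)"
  by (rule summable_comparison_test'[OF summable_conj_bound, of 0]) (rule norm_conj_term_le)

lemma shifted_term_tendsto_0:
  assumes "q \<noteq> 0"
  shows "shifted_term r \<longlonglongrightarrow> 0"
proof -
  have "(\<lambda>m. conj_term r (m + r)) \<longlonglongrightarrow> 0"
    using summable_LIMSEQ_zero[OF summable_conj_term] by (rule LIMSEQ_ignore_initial_segment)
  hence "(\<lambda>m. ((-1) ^ r / q ^ (Suc r choose 2)) * conj_term r (m + r)) \<longlonglongrightarrow> 0"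
    by (rule tendsto_mult_right_zero)
  thus ?thesis
    using assms by (simp add: conj_term_shift flip: power_mult_distrib)
qed

text \<open>
  The WZ certificate showing that the sum of \<open>shifted_term r\<close> does not depend on \<open>r\<close>.
\<close>

definition wz_cert :: "nat \<Rightarrow> nat \<Rightarrow> complex" where
  "wz_cert r m = (1 - q ^ m) * (1 - q ^ (r + m + 1) - q ^ (2 * r + m + 2)) / (1 - q ^ (2 * r + 2 + m))"

lemma one_minus_power_neq_0: "n > 0 \<Longrightarrow> 1 - q ^ n \<noteq> 0"
  using one_minus_power_nonzero[OF q1, of "n - 1"] by (cases n) auto

lemma shifted_term_WZ:
  "shifted_term (Suc r) m - shifted_term r m =
   shifted_term r (Suc m) * wz_cert r (Suc m) - shifted_term r m * wz_cert r m"
proof -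
  \<comment> \<open>In terms of x and y both neighbouring terms are rational multiples of K, so the
    claim becomes an identity of rational functions.\<close>
  define x y where "x = q ^ m" and "y = q ^ r"
  define K where "K = shifted_term r m"
  have nz: "1 - q * x \<noteq> 0" "1 - q\<^sup>2 * y\<^sup>2 * x \<noteq> 0" "1 - q ^ 3 * y\<^sup>2 * x \<noteq> 0"
    using one_minus_power_neq_0[of "Suc m"] one_minus_power_neq_0[of "2 + r * 2 + m"]
      one_minus_power_neq_0[of "3 + r * 2 + m"]
    by (simp_all add: x_def y_def power_add power_mult power2_eq_square power3_eq_cube mult_ac)
  have 1: "shifted_term (Suc r) m = K * (x * (1 - q * y * x) / ((1 - q\<^sup>2 * y\<^sup>2 * x) * (1 - q ^ 3 * y\<^sup>2 * x)))"
  proof -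
    have "2 * Suc r + 1 + m = Suc (Suc (2 * r + 1 + m))" by simp
    thus ?thesis using nz
      by (simp add: K_def shifted_term_def qpoch_Suc x_def y_def power_add
          power_mult power2_eq_square power3_eq_cube divide_simps) (simp add: algebra_simps)
  qed
  have 2: "shifted_term r (Suc m) = K * (- (q * y * x * (1 - q * y * x)) / ((1 - q * x) * (1 - q\<^sup>2 * y\<^sup>2 * x)))"
  proof -
    have "2 * r + 1 + Suc m = Suc (2 * r + 1 + m)" "Suc (Suc m) choose 2 = Suc m + (Suc m choose 2)"
      by (simp_all add: numeral_2_eq_2)
    thus ?thesis using nz
      by (simp add: K_def shifted_term_def qpoch_Suc x_def y_def power_add
          power_mult power2_eq_square power3_eq_cube divide_simps) (simp add: algebra_simps)
  qed
  have 3: "wz_cert r m = (1 - x) * (1 - q * y * x - q\<^sup>2 * y\<^sup>2 * x) / (1 - q\<^sup>2 * y\<^sup>2 * x)"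
    by (simp add: wz_cert_def x_def y_def power_add power_mult power2_eq_square algebra_simps mult_2)
  have 4: "wz_cert r (Suc m) = (1 - q * x) * (1 - q\<^sup>2 * y * x - q ^ 3 * y\<^sup>2 * x) / (1 - q ^ 3 * y\<^sup>2 * x)"
    by (simp add: wz_cert_def x_def y_def power_add power_mult power2_eq_square power3_eq_cube
        algebra_simps mult_2)
  have "x * (1 - q * y * x) / ((1 - q\<^sup>2 * y\<^sup>2 * x) * (1 - q ^ 3 * y\<^sup>2 * x)) - 1 =
      (- (q * y * x * (1 - q * y * x)) / ((1 - q * x) * (1 - q\<^sup>2 * y\<^sup>2 * x)))
      * ((1 - q * x) * (1 - q\<^sup>2 * y * x - q ^ 3 * y\<^sup>2 * x) / (1 - q ^ 3 * y\<^sup>2 * x))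
      - (1 - x) * (1 - q * y * x - q\<^sup>2 * y\<^sup>2 * x) / (1 - q\<^sup>2 * y\<^sup>2 * x)"
    using nz by (simp add: divide_simps) (simp add: algebra_simps power2_eq_square power3_eq_cube)
  thus ?thesis
    unfolding 1 2 3 4 K_def[symmetric] by (metis (no_types, opaque_lifting) mult.assoc mult.right_neutral right_diff_distrib)
qed

lemma norm_wz_cert_le: "norm (wz_cert r m) \<le> 6 / (1 - norm q)"
proof -
  have le1: "norm (q ^ n) \<le> 1" for n
    using q1 by (simp add: norm_power power_le_one)
  have "norm (1 - q ^ m) \<le> 2"
    using norm_triangle_ineq4[of 1 "q ^ m"] le1[of m] by simp
  moreover have "norm (1 - q ^ (r + m + 1) - q ^ (2 * r + m + 2)) \<le> 3"
    using norm_triangle_ineq4[of "1 - q ^ (r + m + 1)" "q ^ (2 * r + m + 2)"]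
      norm_triangle_ineq4[of 1 "q ^ (r + m + 1)"] le1[of "r + m + 1"] le1[of "2 * r + m + 2"]
    by simp
  ultimately have num: "norm (1 - q ^ m) * norm (1 - q ^ (r + m + 1) - q ^ (2 * r + m + 2)) \<le> 2 * 3"
    by (intro mult_mono) auto
  have "norm (q ^ (2 * r + 2 + m)) \<le> norm q ^ 1"
    unfolding norm_power using q1 by (intro power_decreasing) auto
  hence "1 - norm q \<le> norm (1 - q ^ (2 * r + 2 + m))"
    using norm_triangle_ineq2[of 1 "q ^ (2 * r + 2 + m)"] by simp
  thus ?thesis
    using num q1 unfolding wz_cert_def norm_divide norm_mult by (intro frac_le) auto
qed

lemma shifted_term_sums_1:
  assumes "q \<noteq> 0"
  shows "shifted_term r sums 1"
proof (induction r)
  case 0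
  \<comment> \<open>For r = 0 the terms are differences of consecutive values of G. As G tends to 0,
    the sum is -G(0) = 1.\<close>
  define G where "G m = - ((-1) ^ m * q ^ (Suc m choose 2) / qpoch q q m)" for m
  have "G = (\<lambda>m. - (shifted_term 0 m * (1 - q ^ Suc m)))"
    using one_minus_power_nonzero[OF q1]
    by (auto simp: fun_eq_iff G_def shifted_term_def qpoch_Suc)
  moreover have "(\<lambda>m. - (shifted_term 0 m * (1 - q ^ Suc m))) \<longlonglongrightarrow> - (0 * (1 - 0))"
    using q1 by (intro tendsto_intros shifted_term_tendsto_0 assms LIMSEQ_Suc LIMSEQ_power_zero)
  ultimately have "(\<lambda>m. G (Suc m) - G m) sums (0 - G 0)"
    by (intro telescope_sums) simp
  moreover have "G (Suc m) - G m = shifted_term 0 m" for m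
  proof -
    have "Suc (Suc m) choose 2 = Suc m + (Suc m choose 2)" by (simp add: numeral_2_eq_2)
    thus ?thesis
      using one_minus_power_nonzero[OF q1, of m]
      by (simp add: G_def shifted_term_def qpoch_Suc power_add divide_simps)
         (simp add: algebra_simps)
  qed
  moreover have "0 - G 0 = 1" by (simp add: G_def numeral_2_eq_2)
  ultimately show ?case by simp
next
  case (Suc r)
  \<comment> \<open>The telescoped difference has no boundary terms: the certificate is bounded as m
    grows, and its factor 1 - q^m vanishes at m = 0. Hence the sums for r and r + 1 agree.\<close>
  have "(\<lambda>m. shifted_term r m * wz_cert r m) \<longlonglongrightarrow> 0"
  proof (rule Lim_null_comparison)
    show "\<forall>\<^sub>F m in sequentially. norm (shifted_term r m * wz_cert r m)
            \<le> norm (shifted_term r m) * (6 / (1 - norm q))"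
      by (simp only: norm_mult) (intro always_eventually allI mult_left_mono norm_wz_cert_le norm_ge_zero)
    show "(\<lambda>m. norm (shifted_term r m) * (6 / (1 - norm q))) \<longlonglongrightarrow> 0"
      by (intro tendsto_mult_left_zero tendsto_norm_zero shifted_term_tendsto_0 assms)
  qed
  hence "(\<lambda>m. shifted_term (Suc r) m - shifted_term r m) sums (0 - shifted_term r 0 * wz_cert r 0)"
    unfolding shifted_term_WZ by (rule telescope_sums)
  hence "(\<lambda>m. shifted_term (Suc r) m - shifted_term r m) sums 0"
    by (simp add: wz_cert_def)
  from sums_add[OF this Suc] show ?case by simp
qed

lemma conj_term_sums:
  assumes "q \<noteq> 0"
  shows "conj_term r sums ((-1) ^ r * q ^ (Suc r choose 2))"
proof -
  have "(\<lambda>m. conj_term r (m + r)) sums ((-1) ^ r * q ^ (Suc r choose 2) * 1)"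
    unfolding conj_term_shift by (intro sums_mult shifted_term_sums_1 assms)
  moreover have "conj_term r n = 0" if "n < r" for n
    using that by (simp add: conj_term_def)
  ultimately show ?thesis
    using sums_zero_iff_shift[of r "conj_term r"] by simp
qed

text \<open>The sums over n and r are interchanged by Tannery's theorem: partial sums over n
  converge for each r and are bounded by \<open>suminf conj_bound\<close>, uniformly in r and their
  length.\<close>

lemma bailey_sum:
  fixes \<alpha> :: "nat \<Rightarrow> complex"
  assumes "q \<noteq> 0" and \<alpha>: "summable (\<lambda>r. norm (\<alpha> r))"
  shows "(\<lambda>n. \<Sum>r\<le>n. \<alpha> r * conj_term r n) sums (\<Sum>r. (-1) ^ r * q ^ (Suc r choose 2) * \<alpha> r)"
proof -
  define a where "a r N = \<alpha> r * (\<Sum>n<N. conj_term r n)" for r N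
  have lim: "(\<lambda>N. a r N) \<longlonglongrightarrow> (-1) ^ r * q ^ (Suc r choose 2) * \<alpha> r" for r
  proof -
    have "(\<lambda>N. a r N) \<longlonglongrightarrow> \<alpha> r * ((-1) ^ r * q ^ (Suc r choose 2))"
      using conj_term_sums[OF assms(1), of r] unfolding sums_def a_def
      by (rule tendsto_mult_left)
    thus ?thesis by (simp only: mult.commute)
  qed
  have bound: "norm (a r N) \<le> norm (\<alpha> r) * suminf conj_bound" for r N
  proof -
    have "norm (\<Sum>n<N. conj_term r n) \<le> (\<Sum>n<N. conj_bound n)"
      by (intro sum_norm_le norm_conj_term_le)
    also have "\<dots> \<le> suminf conj_bound"
      by (intro sum_le_suminf summable_conj_bound conj_bound_nonneg) auto
    finally show ?thesis unfolding a_def norm_mult by (intro mult_left_mono) auto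
  qed
  have "(\<lambda>N. \<Sum>r. a r N) \<longlonglongrightarrow> (\<Sum>r. (-1) ^ r * q ^ (Suc r choose 2) * \<alpha> r)"
    using tannerys_theorem[of a "\<lambda>r. (-1) ^ r * q ^ (Suc r choose 2) * \<alpha> r" sequentially
        "\<lambda>r. norm (\<alpha> r) * suminf conj_bound"] lim bound summable_mult2[OF \<alpha>]
    by (auto intro: always_eventually)
  moreover have "(\<Sum>r. a r N) = (\<Sum>n<N. \<Sum>r\<le>n. \<alpha> r * conj_term r n)" for N
  proof -
    have "(\<Sum>r. a r N) = (\<Sum>r<N. a r N)"
    proof (rule suminf_finite)
      fix r assume "r \<notin> {..<N}"
      hence "conj_term r n = 0" if "n < N" for n
        using that by (simp add: conj_term_def)
      thus "a r N = 0" by (simp add: a_def)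
    qed simp
    also have "\<dots> = (\<Sum>n<N. \<Sum>r<N. \<alpha> r * conj_term r n)"
      unfolding a_def sum_distrib_left by (rule sum.swap)
    also have "\<dots> = (\<Sum>n<N. \<Sum>r\<le>n. \<alpha> r * conj_term r n)"
      by (intro sum.cong refl sum.mono_neutral_right) (auto simp: conj_term_def)
    finally show ?thesis .
  qed
  ultimately show ?thesis by (simp add: sums_def)
qed

text \<open>The positions n - r and n + r + 1 carry the same coefficient, and n - i equals r and -1
  - r there. Thus the Bailey sequence is \<alpha>(r) = f(r) + f(-1 - r).\<close>

lemma qsum_fold:
  "qsum q (Suc (2 * n)) (\<lambda>i. f (int n - int i)) =
   (\<Sum>r\<le>n. (f (int r) + f (- 1 - int r)) * qbinom q (Suc (2 * n)) (n - r))"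
proof -
  let ?b = "qbinom q (Suc (2 * n))"
  have "{..Suc (2 * n)} = {..n} \<union> {Suc n..Suc (2 * n)}" by auto
  hence "qsum q (Suc (2 * n)) (\<lambda>i. f (int n - int i))
        = (\<Sum>i\<le>n. f (int n - int i) * ?b i) + (\<Sum>i\<in>{Suc n..Suc (2 * n)}. f (int n - int i) * ?b i)"
    unfolding qsum_def by (subst sum.union_disjoint[symmetric]) auto
  also have "(\<Sum>i\<le>n. f (int n - int i) * ?b i) = (\<Sum>r\<le>n. f (int r) * ?b (n - r))"
    by (rule sum.reindex_bij_witness[of _ "\<lambda>r. n - r" "\<lambda>i. n - i"]) (auto simp: of_nat_diff)
  also have "(\<Sum>i\<in>{Suc n..Suc (2 * n)}. f (int n - int i) * ?b i)
             = (\<Sum>r\<le>n. f (- 1 - int r) * ?b (n + r + 1))"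
    by (rule sum.reindex_bij_witness[of _ "\<lambda>r. n + r + 1" "\<lambda>i. i - Suc n"]) (auto simp: of_nat_diff)
  also have "\<dots> = (\<Sum>r\<le>n. f (- 1 - int r) * ?b (n - r))"
  proof (intro sum.cong refl)
    fix r assume "r \<in> {..n}"
    hence "Suc (2 * n) - (n - r) = n + r + 1" "n - r \<le> Suc (2 * n)" by auto
    thus "f (- 1 - int r) * ?b (n + r + 1) = f (- 1 - int r) * ?b (n - r)"
      by (metis qbinom_symmetric)
  qed
  finally show ?thesis by (simp add: sum.distrib distrib_right)
qed

lemma qsum_transform:
  fixes f :: "int \<Rightarrow> complex" and w :: "nat \<Rightarrow> complex"
  assumes "q \<noteq> 0"
    and w: "\<And>n. qsum q (Suc (2 * n)) (\<lambda>i. f (int n - int i)) = w n"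
    and "summable (\<lambda>r. norm (f (int r) + f (- 1 - int r)))"
  shows "(\<lambda>n. (-1) ^ n * q ^ (Suc n choose 2) * w n / qpoch (q ^ (n + 1)) q (n + 1)) sums
         (\<Sum>r. (-1) ^ r * q ^ (Suc r choose 2) * (f (int r) + f (- 1 - int r)))"
proof -
  have "(\<Sum>r\<le>n. (f (int r) + f (- 1 - int r)) * conj_term r n)
        = (-1) ^ n * q ^ (Suc n choose 2) * w n / qpoch (q ^ (n + 1)) q (n + 1)" for n
  proof -
    \<comment> \<open>This factorisation rewrites \<open>conj_term r n\<close> as an r-independent
      factor times the Gaussian binomial coefficient in \<open>qsum_fold\<close>.\<close>
    have E: "qpoch q q (Suc (2 * n)) = qpoch q q n * qpoch (q ^ (n + 1)) q (n + 1)"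
      using qpoch_add[of q n "n + 1"] by (simp add: mult_2)
    have "conj_term r n = (-1) ^ n * q ^ (Suc n choose 2) / qpoch (q ^ (n + 1)) q (n + 1)
                          * qbinom q (Suc (2 * n)) (n - r)" if "r \<le> n" for r
    proof -
      have "Suc (2 * n) - (n - r) = n + r + 1" using that by simp
      moreover have "qpoch (q ^ (n + 1)) q (n + 1) \<noteq> 0"
        using qpoch_nonzero[OF q1, of n] by simp
      ultimately show ?thesis
        using that by (simp add: conj_term_def qbinom_def E del: power_Suc)
    qed
    hence "(\<Sum>r\<le>n. (f (int r) + f (- 1 - int r)) * conj_term r n)
           = (-1) ^ n * q ^ (Suc n choose 2) / qpoch (q ^ (n + 1)) q (n + 1)
             * (\<Sum>r\<le>n. (f (int r) + f (- 1 - int r)) * qbinom q (Suc (2 * n)) (n - r))"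
      unfolding sum_distrib_left by (intro sum.cong refl) (simp del: power_Suc add_Suc_right)
    thus ?thesis by (simp add: w qsum_fold[symmetric])
  qed
  with bailey_sum[OF assms(1,3)] show ?thesis by simp
qed

text \<open>Summability of h is established first, since convergence of the series grouped in threes
  would not imply it; then both series have the same sum.\<close>

lemma qsum_transform_mod_3:
  fixes f :: "int \<Rightarrow> complex" and w :: "nat \<Rightarrow> complex"
  assumes "q \<noteq> 0"
    and w: "\<And>n. qsum q (Suc (2 * n)) (\<lambda>i. f (int n - int i)) = w n"
    and sf: "summable (\<lambda>r. norm (f (int r)))" "summable (\<lambda>r. norm (f (- 1 - int r)))"
    and h: "\<And>r. h r = (-1) ^ r * q ^ (Suc r choose 2) * (f (int r) + f (- 1 - int r))"
    and S: "(\<lambda>k. h (3 * k) + h (3 * k + 1) + h (3 * k + 2)) sums S"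
  shows "(\<lambda>n. (-1) ^ n * q ^ (Suc n choose 2) * w n / qpoch (q ^ (n + 1)) q (n + 1)) sums S"
proof -
  have sum: "summable (\<lambda>r. norm (f (int r) + f (- 1 - int r)))"
    by (rule summable_comparison_test'[OF summable_add[OF sf], of 0]) (simp add: norm_triangle_ineq)
  have "summable h"
  proof (rule summable_comparison_test'[OF sum, of 0])
    fix r :: nat
    have "norm q ^ (Suc r choose 2) \<le> 1"
      using q1 by (intro power_le_one) auto
    thus "norm (h r) \<le> norm (f (int r) + f (- 1 - int r))"
      unfolding h norm_mult norm_power by (simp add: mult_left_le_one_le)
  qed
  hence "(\<lambda>k. sum h {k * 3..<k * 3 + 3}) sums suminf h"
    by (intro sums_group summable_sums) auto
  moreover have "sum h {k * 3..<k * 3 + 3} = h (3 * k) + h (3 * k + 1) + h (3 * k + 2)" for k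
    by (simp add: numeral_3_eq_3 mult.commute)
  ultimately have "suminf h = S"
    using S by (simp add: sums_unique2)
  thus ?thesis
    using qsum_transform[OF assms(1) w sum] by (simp add: h[abs_def])
qed

end

section \<open>Splitting the transformed series modulo 3\<close>

text \<open>Comparison with a geometric series in |t|. The slack 3 accommodates negative exponents,
  such as -2 at b = 4 and s = -1.\<close>

lemma summable_norm_term3:
  assumes "t \<noteq> 0" "norm t < 1" and "\<And>r. int r - 3 \<le> 2 * (s r) ^ 2 + b * s r"
  shows "summable (\<lambda>r. norm (term3 t b (s r)))"
proof (rule summable_comparison_test')
  show "summable (\<lambda>r. norm t ^ r * norm t powi (-3))"
    using assms(2) by (intro summable_mult2 summable_geometric) auto
  fix r :: nat
  have "norm (chi3 (s r)) \<le> 1" by (simp add: chi3_def)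
  hence "norm (term3 t b (s r)) \<le> 1 * norm t powi (2 * (s r) ^ 2 + b * s r)"
    unfolding term3_def norm_mult norm_power_int by (intro mult_right_mono) auto
  also have "\<dots> \<le> norm t powi (int r + (-3))"
    using assms(1,2) assms(3)[of r] by (simp add: power_int_decreasing)
  also have "\<dots> = norm t ^ r * norm t powi (-3)"
    using assms(1) by (subst power_int_add) auto
  finally show "norm (norm (term3 t b (s r))) \<le> norm t ^ r * norm t powi (-3)" by simp
qed

lemma int_le_square: "int r \<le> (int r)\<^sup>2"
  by (metis le_square of_nat_le_iff of_nat_mult power2_eq_square)

lemma two_times_choose_two: "2 * int (Suc n choose 2) = int n * (int n + 1)"
  by (induction n) (simp_all add: numeral_2_eq_2 algebra_simps)

text \<open>Matching of exponents as polynomial identities: e is the exponent of q belonging to that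
  of t, and the second equation is doubled to clear the halves in the binomial coefficients.\<close>

lemma power_choose_times_term3:
  assumes "t \<noteq> 0" "q = t ^ 3" "2 * s ^ 2 + b * s = 3 * e"
    "int r * (int r + 1) + 2 * e = 2 * int d + 2 * a * int k + 21 * (int k * (int k + 1))"
  shows "q ^ (Suc r choose 2) * term3 t b s =
         chi3 s * (q ^ d * q powi (a * int k + 21 * int ((k + 1) choose 2)))"
proof -
  have "t powi (3 * e) = q powi e"
    by (simp add: assms(2) power_int_mult)
  moreover have "int (Suc r choose 2) + e = int d + (a * int k + 21 * int (Suc k choose 2))"
    using assms(4) two_times_choose_two[of r] two_times_choose_two[of k] by linarith
  ultimately have "q ^ (Suc r choose 2) * t powi (3 * e)
                   = q ^ d * q powi (a * int k + 21 * int (Suc k choose 2))"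
    using assms(1,2) by (metis power_int_add power_int_of_nat power_not_zero)
  thus ?thesis
    unfolding term3_def assms(3) by (simp add: mult.left_commute)
qed

lemma chi3_values:
  "chi3 (3 * m) = 1" "chi3 (3 * m + 1) = -1" "chi3 (3 * m + 2) = 0"
  by (simp_all add: chi3_def)

definition theta_term :: "complex \<Rightarrow> int \<Rightarrow> nat \<Rightarrow> complex" where
  "theta_term q a n = (-1) ^ n * q powi (a * int n + 21 * int ((n + 1) choose 2))"

lemma theta_term_sums:
  assumes "q \<noteq> 0" "norm q < 1"
  shows "theta_term q a sums suminf (theta_term q a)"
  using summable_norm_cancel[OF summable_theta_series[OF assms, of a]]
  unfolding theta_term_def[abs_def] by (rule summable_sums)

context
  fixes t q :: complex
  assumes t0: "t \<noteq> 0" and t1: "norm t < 1" and q: "q = t ^ 3"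
begin

lemma q_bounds: "q \<noteq> 0" "norm q < 1"
  using t0 norm_cube[OF t0 t1] by (simp_all add: q)

text \<open>The contribution of one of the two arguments s that the folded sum attaches to
  r.\<close>

definition weight :: "int \<Rightarrow> nat \<Rightarrow> int \<Rightarrow> complex" where
  "weight b r s = (-1) ^ r * q ^ (Suc r choose 2) * term3 t b s"

lemma weight_eval:
  assumes "2 * s ^ 2 + b * s = 3 * e"
    "int r * (int r + 1) + 2 * e = 2 * int d + 2 * a * int k + 21 * (int k * (int k + 1))"
  shows "weight b r s = (-1) ^ (r + k) * chi3 s * q ^ d * theta_term q a k"
proof -
  have "((-1) ^ k * (-1) ^ k :: complex) = 1"
    by (simp flip: power_mult_distrib)
  hence eq: "(-1) ^ (r + k) * chi3 s * q ^ d * theta_term q a k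
         = (-1) ^ r * (chi3 s * (q ^ d * q powi (a * int k + 21 * int ((k + 1) choose 2))))"
    by (simp add: theta_term_def power_add mult_ac)
  show ?thesis
    using eq by (simp only: weight_def mult.assoc power_choose_times_term3[OF t0 q assms])
qed

lemma weight_mod_0:
  assumes "s = 3 * m" "even (r + k)"
    "int r * (int r + 1) + 2 * (6 * m ^ 2 + b * m) =
       2 * int d + 2 * a * int k + 21 * (int k * (int k + 1))"
  shows "weight b r s = q ^ d * theta_term q a k"
proof -
  have "2 * s ^ 2 + b * s = 3 * (6 * m ^ 2 + b * m)"
    by (simp add: assms(1) power2_eq_square algebra_simps)
  from weight_eval[OF this assms(3)] show ?thesis
    using assms(2) by (simp add: assms(1) chi3_values)
qed

text \<open>For s = 1 modulo 3, the condition b = 1 modulo 3 makes 2s^2 + bs divisible by 3. The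
  additional sign is the value of \<open>chi3\<close>.\<close>

lemma weight_mod_1:
  assumes "s = 3 * m + 1" "b = 3 * e + 1"
    "int r * (int r + 1) + 2 * (6 * m ^ 2 + 4 * m + b * m + e + 1) =
       2 * int d + 2 * a * int k + 21 * (int k * (int k + 1))"
  shows "weight b r s = (-1) ^ Suc (r + k) * q ^ d * theta_term q a k"
proof -
  have "2 * s ^ 2 + b * s = 3 * (6 * m ^ 2 + 4 * m + b * m + e + 1)"
    by (simp add: assms(1,2) power2_eq_square algebra_simps)
  from weight_eval[OF this assms(3)] show ?thesis
    by (simp add: assms(1) chi3_values)
qed

lemma weight_mod_2: "s = 3 * m + 2 \<Longrightarrow> weight b r s = 0"
  by (simp add: weight_def term3_def chi3_values)

text \<open>The six weights are the arguments r + j and j - 1 - r for r = 3k, 3k + 1, 3k + 2. In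
  each application two of them are 2 modulo 3 and drop out, leaving four theta series.\<close>

lemma term3_transform:
  assumes w: "\<And>n. qsum q (Suc (2 * n)) (\<lambda>i. term3 t b (int n + j - int i)) = w n"
    and bounds: "\<And>r. int r - 3 \<le> 2 * (int r + j)\<^sup>2 + b * (int r + j)"
      "\<And>r. int r - 3 \<le> 2 * (j - 1 - int r)\<^sup>2 + b * (j - 1 - int r)"
    and g: "\<And>k. weight b (3 * k) (3 * int k + j) + weight b (3 * k) (j - 1 - 3 * int k)
      + (weight b (3 * k + 1) (3 * int k + 1 + j) + weight b (3 * k + 1) (j - 2 - 3 * int k))
      + (weight b (3 * k + 2) (3 * int k + 2 + j) + weight b (3 * k + 2) (j - 3 - 3 * int k)) = g k"
    and S: "g sums S"
  shows "(\<lambda>n. (-1) ^ n * q ^ (Suc n choose 2) * w n / qpoch (q ^ (n + 1)) q (n + 1)) sums S"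
proof (rule qsum_transform_mod_3[OF q_bounds(2,1)])
  let ?f = "\<lambda>r. term3 t b (r + j)"
  let ?h = "\<lambda>r. weight b r (int r + j) + weight b r (j - 1 - int r)"
  show "qsum q (Suc (2 * n)) (\<lambda>i. ?f (int n - int i)) = w n" for n
    using w[of n] by (simp only: diff_add_eq)
  show "summable (\<lambda>r. norm (?f (int r)))"
    by (intro summable_norm_term3[OF t0 t1] bounds)
  have "- 1 - int r + j = j - 1 - int r" for r by simp
  thus "summable (\<lambda>r. norm (?f (- 1 - int r)))"
    by (simp only: summable_norm_term3[OF t0 t1 bounds(2)])
  show "?h r = (-1) ^ r * q ^ (Suc r choose 2) * (?f (int r) + ?f (- 1 - int r))" for r
    by (simp add: weight_def distrib_left algebra_simps)
  have "?h (3 * k) + ?h (3 * k + 1) + ?h (3 * k + 2) = g k" for k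
    unfolding g[symmetric] by (simp add: algebra_simps)
  thus "(\<lambda>k. ?h (3 * k) + ?h (3 * k + 1) + ?h (3 * k + 2)) sums S"
    using S by simp
qed

section \<open>The three transformed series\<close>

lemma shifted_series_sums:
  "(\<lambda>n. (-1) ^ n * q ^ (Suc n choose 2) * (1 - q ^ Suc (2 * n)) / qpoch (q ^ (n + 1)) q (n + 1)) sums
   (suminf (theta_term q (-10)) + q ^ 10 * suminf (theta_term q 10)
     - q * suminf (theta_term q (-4)) - q ^ 5 * suminf (theta_term q 4))"
proof (rule term3_transform[where b = 1 and j = 1])
  show "qsum q (Suc (2 * n)) (\<lambda>i. term3 t 1 (int n + 1 - int i)) = (1 - q ^ Suc (2 * n))" for n
    using qsum_odd_shifted[OF t0 t1, of n] by (simp only: q add_0_right)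
  fix r
  show "int r - 3 \<le> 2 * (int r + 1)\<^sup>2 + 1 * (int r + 1)"
       "int r - 3 \<le> 2 * (1 - 1 - int r)\<^sup>2 + 1 * (1 - 1 - int r)"
    using int_le_square[of r] by (simp_all add: power2_eq_square algebra_simps)
next
  fix k
  \<comment> \<open>Here d and a come from expanding r(r+1)/2 + (2s^2 + s)/3 in k: d is the value at
    k = 0, and a the linear coefficient left after removing 21k(k+1)/2. In this case the exponent is
    1 - 4k + 21k(k+1)/2.\<close>
  have 1: "weight 1 (3 * k) (3 * int k + 1) = - (q ^ 1 * theta_term q (-4) k)"
    by (subst weight_mod_1[where m = "int k" and e = 0 and d = 1 and a = "(-4)" and k = k])
       (simp_all add: power2_eq_square algebra_simps minus_one_power_iff)
  have 2: "weight 1 (3 * k) (1 - 1 - 3 * int k) = q ^ 0 * theta_term q (-10) k"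
    by (rule weight_mod_0[where m = "- int k"]) (simp_all add: power2_eq_square algebra_simps)
  have 3: "weight 1 (3 * k + 2) (3 * int k + 2 + 1) = q ^ 10 * theta_term q 10 k"
    by (rule weight_mod_0[where m = "int k + 1"]) (simp_all add: power2_eq_square algebra_simps)
  have 4: "weight 1 (3 * k + 2) (1 - 3 - 3 * int k) = - (q ^ 5 * theta_term q 4 k)"
    by (subst weight_mod_1[where m = "- int k - 1" and e = 0 and d = 5 and a = "4" and k = k])
       (simp_all add: power2_eq_square algebra_simps minus_one_power_iff)
  have 5: "weight 1 (3 * k + 1) (3 * int k + 1 + 1) = 0"
    by (rule weight_mod_2[where m = "int k"]) simp
  have 6: "weight 1 (3 * k + 1) (1 - 2 - 3 * int k) = 0"
    by (rule weight_mod_2[where m = "- int k - 1"]) simp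
  show "weight 1 (3 * k) (3 * int k + 1) + weight 1 (3 * k) (1 - 1 - 3 * int k)
      + (weight 1 (3 * k + 1) (3 * int k + 1 + 1) + weight 1 (3 * k + 1) (1 - 2 - 3 * int k))
      + (weight 1 (3 * k + 2) (3 * int k + 2 + 1) + weight 1 (3 * k + 2) (1 - 3 - 3 * int k)) =
      theta_term q (-10) k + q ^ 10 * theta_term q 10 k
        - q * theta_term q (-4) k - q ^ 5 * theta_term q 4 k"
    unfolding 1 2 3 4 5 6 by simp
next
  show "(\<lambda>k. theta_term q (-10) k + q ^ 10 * theta_term q 10 k
    - q * theta_term q (-4) k - q ^ 5 * theta_term q 4 k) sums
    (suminf (theta_term q (-10)) + q ^ 10 * suminf (theta_term q 10)
      - q * suminf (theta_term q (-4)) - q ^ 5 * suminf (theta_term q 4))"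
    using q_bounds by (intro sums_add sums_diff sums_mult theta_term_sums)
qed

lemma unit_series_sums:
  "(\<lambda>n. (-1) ^ n * q ^ (Suc n choose 2) * 1 / qpoch (q ^ (n + 1)) q (n + 1)) sums
   (suminf (theta_term q (-8)) + q ^ 8 * suminf (theta_term q 8)
     + q ^ 2 * suminf (theta_term q (-1)) + q ^ 3 * suminf (theta_term q 1))"
proof (rule term3_transform[where b = 1 and j = 0])
  show "qsum q (Suc (2 * n)) (\<lambda>i. term3 t 1 (int n + 0 - int i)) = 1" for n
    using qsum_odd[OF t0 t1, of n] by (simp only: q add_0_right)
  fix r
  show "int r - 3 \<le> 2 * (int r + 0)\<^sup>2 + 1 * (int r + 0)"
       "int r - 3 \<le> 2 * (0 - 1 - int r)\<^sup>2 + 1 * (0 - 1 - int r)"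
    using int_le_square[of r] by (simp_all add: power2_eq_square algebra_simps)
next
  fix k
  have 1: "weight 1 (3 * k) (3 * int k + 0) = q ^ 0 * theta_term q (-8) k"
    by (rule weight_mod_0[where m = "int k"]) (simp_all add: power2_eq_square algebra_simps)
  have 2: "weight 1 (3 * k + 1) (3 * int k + 1 + 0) = q ^ 2 * theta_term q (-1) k"
    by (subst weight_mod_1[where m = "int k" and e = 0 and d = 2 and a = "(-1)" and k = k])
       (simp_all add: power2_eq_square algebra_simps minus_one_power_iff)
  have 3: "weight 1 (3 * k + 1) (0 - 2 - 3 * int k) = q ^ 3 * theta_term q 1 k"
    by (subst weight_mod_1[where m = "- int k - 1" and e = 0 and d = 3 and a = "1" and k = k])
       (simp_all add: power2_eq_square algebra_simps minus_one_power_iff)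
  have 4: "weight 1 (3 * k + 2) (0 - 3 - 3 * int k) = q ^ 8 * theta_term q 8 k"
    by (rule weight_mod_0[where m = "- int k - 1"]) (simp_all add: power2_eq_square algebra_simps)
  have 5: "weight 1 (3 * k) (0 - 1 - 3 * int k) = 0"
    by (rule weight_mod_2[where m = "- int k - 1"]) simp
  have 6: "weight 1 (3 * k + 2) (3 * int k + 2 + 0) = 0"
    by (rule weight_mod_2[where m = "int k"]) simp
  show "weight 1 (3 * k) (3 * int k + 0) + weight 1 (3 * k) (0 - 1 - 3 * int k)
      + (weight 1 (3 * k + 1) (3 * int k + 1 + 0) + weight 1 (3 * k + 1) (0 - 2 - 3 * int k))
      + (weight 1 (3 * k + 2) (3 * int k + 2 + 0) + weight 1 (3 * k + 2) (0 - 3 - 3 * int k)) =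
      theta_term q (-8) k + q ^ 8 * theta_term q 8 k
        + q ^ 2 * theta_term q (-1) k + q ^ 3 * theta_term q 1 k"
    unfolding 1 2 3 4 5 6 by simp
next
  show "(\<lambda>k. theta_term q (-8) k + q ^ 8 * theta_term q 8 k
    + q ^ 2 * theta_term q (-1) k + q ^ 3 * theta_term q 1 k) sums
    (suminf (theta_term q (-8)) + q ^ 8 * suminf (theta_term q 8)
      + q ^ 2 * suminf (theta_term q (-1)) + q ^ 3 * suminf (theta_term q 1))"
    using q_bounds by (intro sums_add sums_diff sums_mult theta_term_sums)
qed

lemma power_series_sums:
  "(\<lambda>n. (-1) ^ n * q ^ (Suc n choose 2) * q ^ n / qpoch (q ^ (n + 1)) q (n + 1)) sums
   (suminf (theta_term q (-5)) + q ^ 5 * suminf (theta_term q 5)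
     + q * suminf (theta_term q (-2)) + q ^ 3 * suminf (theta_term q 2))"
proof (rule term3_transform[where b = 4 and j = 0])
  show "qsum q (Suc (2 * n)) (\<lambda>i. term3 t 4 (int n + 0 - int i)) = q ^ n" for n
    using qsum_odd_4[OF t0 t1, of n] by (simp only: q add_0_right)
  fix r
  show "int r - 3 \<le> 2 * (int r + 0)\<^sup>2 + 4 * (int r + 0)"
       "int r - 3 \<le> 2 * (0 - 1 - int r)\<^sup>2 + 4 * (0 - 1 - int r)"
    using int_le_square[of r] by (simp_all add: power2_eq_square algebra_simps)
next
  fix k
  have 1: "weight 4 (3 * k) (3 * int k + 0) = q ^ 0 * theta_term q (-5) k"
    by (rule weight_mod_0[where m = "int k"]) (simp_all add: power2_eq_square algebra_simps)
  have 2: "weight 4 (3 * k + 1) (3 * int k + 1 + 0) = q ^ 3 * theta_term q 2 k"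
    by (subst weight_mod_1[where m = "int k" and e = 1 and d = 3 and a = "2" and k = k])
       (simp_all add: power2_eq_square algebra_simps minus_one_power_iff)
  have 3: "weight 4 (3 * k + 1) (0 - 2 - 3 * int k) = q ^ 1 * theta_term q (-2) k"
    by (subst weight_mod_1[where m = "- int k - 1" and e = 1 and d = 1 and a = "(-2)" and k = k])
       (simp_all add: power2_eq_square algebra_simps minus_one_power_iff)
  have 4: "weight 4 (3 * k + 2) (0 - 3 - 3 * int k) = q ^ 5 * theta_term q 5 k"
    by (rule weight_mod_0[where m = "- int k - 1"]) (simp_all add: power2_eq_square algebra_simps)
  have 5: "weight 4 (3 * k) (0 - 1 - 3 * int k) = 0"
    by (rule weight_mod_2[where m = "- int k - 1"]) simp
  have 6: "weight 4 (3 * k + 2) (3 * int k + 2 + 0) = 0"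
    by (rule weight_mod_2[where m = "int k"]) simp
  show "weight 4 (3 * k) (3 * int k + 0) + weight 4 (3 * k) (0 - 1 - 3 * int k)
      + (weight 4 (3 * k + 1) (3 * int k + 1 + 0) + weight 4 (3 * k + 1) (0 - 2 - 3 * int k))
      + (weight 4 (3 * k + 2) (3 * int k + 2 + 0) + weight 4 (3 * k + 2) (0 - 3 - 3 * int k)) =
      theta_term q (-5) k + q ^ 5 * theta_term q 5 k
        + q * theta_term q (-2) k + q ^ 3 * theta_term q 2 k"
    unfolding 1 2 3 4 5 6 by simp
next
  show "(\<lambda>k. theta_term q (-5) k + q ^ 5 * theta_term q 5 k
    + q * theta_term q (-2) k + q ^ 3 * theta_term q 2 k) sums
    (suminf (theta_term q (-5)) + q ^ 5 * suminf (theta_term q 5)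
      + q * suminf (theta_term q (-2)) + q ^ 3 * suminf (theta_term q 2))"
    using q_bounds by (intro sums_add sums_diff sums_mult theta_term_sums)
qed

end

section \<open>From the transformed series to the stated identities\<close>

theorem theorem3p2:
  fixes q :: complex
  assumes "0 < norm q" and "norm q < 1"
  shows "((\<Sum>n. (-1) ^ n * q ^ ((n + 1) choose 2) / qpoch (q ^ (n + 1)) q n) =
            (\<Sum>n. (-1) ^ n * q powi (- 10 * int n + 21 * int ((n + 1) choose 2)))
          + q ^ 10 * (\<Sum>n. (-1) ^ n * q powi (10 * int n + 21 * int ((n + 1) choose 2)))
          - q * (\<Sum>n. (-1) ^ n * q powi (- 4 * int n + 21 * int ((n + 1) choose 2)))
          - q ^ 5 * (\<Sum>n. (-1) ^ n * q powi (4 * int n + 21 * int ((n + 1) choose 2))))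
       \<and> ((\<Sum>n. (-1) ^ (n + 1) * q ^ ((n + 1) choose 2) / qpoch (q ^ (n + 1)) q (n + 1)) =
          - (\<Sum>n. (-1) ^ n * q powi (- 8 * int n + 21 * int ((n + 1) choose 2)))
          - q ^ 8 * (\<Sum>n. (-1) ^ n * q powi (8 * int n + 21 * int ((n + 1) choose 2)))
          - q ^ 2 * (\<Sum>n. (-1) ^ n * q powi (- int n + 21 * int ((n + 1) choose 2)))
          - q ^ 3 * (\<Sum>n. (-1) ^ n * q powi (int n + 21 * int ((n + 1) choose 2))))
       \<and> ((\<Sum>n. (-1) ^ (n + 1) * q ^ ((n + 2) choose 2) / qpoch (q ^ (n + 1)) q (n + 1)) =
          - q * (\<Sum>n. (-1) ^ n * q powi (- 5 * int n + 21 * int ((n + 1) choose 2)))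
          - q ^ 6 * (\<Sum>n. (-1) ^ n * q powi (5 * int n + 21 * int ((n + 1) choose 2)))
          - q ^ 2 * (\<Sum>n. (-1) ^ n * q powi (- 2 * int n + 21 * int ((n + 1) choose 2)))
          - q ^ 4 * (\<Sum>n. (-1) ^ n * q powi (2 * int n + 21 * int ((n + 1) choose 2))))"
proof -
  \<comment> \<open>The identities involve q alone, so the choice of cube root is immaterial; the
    principal logarithm supplies one.\<close>
  define t where "t = exp (Ln q / 3)"
  have "q \<noteq> 0" using assms(1) by auto
  hence q: "q = t ^ 3"
    by (simp add: t_def flip: exp_of_nat_mult)
  have t: "t \<noteq> 0" "norm t < 1"
  proof -
    show "t \<noteq> 0" by (simp add: t_def)
    have "norm t ^ 3 < 1 ^ 3"
      using assms(2) by (simp add: q norm_power)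
    thus "norm t < 1"
      by (rule power_less_imp_less_base) simp
  qed
  have theta: "suminf (theta_term q a) =
      (\<Sum>n. (-1) ^ n * q powi (a * int n + 21 * int ((n + 1) choose 2)))" for a
    by (simp add: theta_term_def[abs_def])
  have "(-1) ^ n * q ^ (Suc n choose 2) * (1 - q ^ Suc (2 * n)) / qpoch (q ^ (n + 1)) q (n + 1)
        = (-1) ^ n * q ^ ((n + 1) choose 2) / qpoch (q ^ (n + 1)) q n" for n
  proof -
    have "q ^ (n + 1) * q ^ n = q ^ Suc (2 * n)"
      by (simp add: mult_2 power_add)
    moreover have "1 - q ^ Suc (2 * n) \<noteq> 0"
      using one_minus_power_nonzero[OF assms(2), of "2 * n"] by simp
    ultimately show ?thesis
      using qpoch_Suc[of "q ^ (n + 1)" q n] by (simp del: power_Suc)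
  qed
  with shifted_series_sums[OF t q]
  have 1: "(\<lambda>n. (-1) ^ n * q ^ ((n + 1) choose 2) / qpoch (q ^ (n + 1)) q n) sums
     (suminf (theta_term q (-10)) + q ^ 10 * suminf (theta_term q 10)
       - q * suminf (theta_term q (-4)) - q ^ 5 * suminf (theta_term q 4))"
    by (simp only:)
  have 2: "(\<lambda>n. (-1) ^ (n + 1) * q ^ ((n + 1) choose 2) / qpoch (q ^ (n + 1)) q (n + 1)) sums
     - (suminf (theta_term q (-8)) + q ^ 8 * suminf (theta_term q 8)
        + q ^ 2 * suminf (theta_term q (-1)) + q ^ 3 * suminf (theta_term q 1))"
    using sums_minus[OF unit_series_sums[OF t q]] by simp
  \<comment> \<open>Multiplication by -q completes the exponent, as n + 1 plus n(n+1)/2 is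
    (n+1)(n+2)/2, and supplies the sign.\<close>
  have "- q * ((-1) ^ n * q ^ (Suc n choose 2) * q ^ n / qpoch (q ^ (n + 1)) q (n + 1))
        = (-1) ^ (n + 1) * q ^ ((n + 2) choose 2) / qpoch (q ^ (n + 1)) q (n + 1)" for n
  proof -
    have "(n + 2) choose 2 = Suc n + (Suc n choose 2)" by (simp add: numeral_2_eq_2)
    thus ?thesis by (simp add: power_add)
  qed
  with sums_mult[OF power_series_sums[OF t q], of "- q"]
  have 3: "(\<lambda>n. (-1) ^ (n + 1) * q ^ ((n + 2) choose 2) / qpoch (q ^ (n + 1)) q (n + 1)) sums
     (- q * (suminf (theta_term q (-5)) + q ^ 5 * suminf (theta_term q 5)
        + q * suminf (theta_term q (-2)) + q ^ 3 * suminf (theta_term q 2)))"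
    by (simp only:)
  have distrib: "- q * (a + q ^ 5 * b + q * c + q ^ 3 * d)
      = - q * a - q ^ 6 * b - q ^ 2 * c - q ^ 4 * d" for a b c d
    by (simp add: algebra_simps eval_nat_numeral)
  show ?thesis
  proof (intro conjI)
    show "(\<Sum>n. (-1) ^ n * q ^ ((n + 1) choose 2) / qpoch (q ^ (n + 1)) q n) =
            (\<Sum>n. (-1) ^ n * q powi (- 10 * int n + 21 * int ((n + 1) choose 2)))
          + q ^ 10 * (\<Sum>n. (-1) ^ n * q powi (10 * int n + 21 * int ((n + 1) choose 2)))
          - q * (\<Sum>n. (-1) ^ n * q powi (- 4 * int n + 21 * int ((n + 1) choose 2)))
          - q ^ 5 * (\<Sum>n. (-1) ^ n * q powi (4 * int n + 21 * int ((n + 1) choose 2)))"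
      using sums_unique[OF 1] by (simp only: theta)
    show "(\<Sum>n. (-1) ^ (n + 1) * q ^ ((n + 1) choose 2) / qpoch (q ^ (n + 1)) q (n + 1)) =
          - (\<Sum>n. (-1) ^ n * q powi (- 8 * int n + 21 * int ((n + 1) choose 2)))
          - q ^ 8 * (\<Sum>n. (-1) ^ n * q powi (8 * int n + 21 * int ((n + 1) choose 2)))
          - q ^ 2 * (\<Sum>n. (-1) ^ n * q powi (- int n + 21 * int ((n + 1) choose 2)))
          - q ^ 3 * (\<Sum>n. (-1) ^ n * q powi (int n + 21 * int ((n + 1) choose 2)))"
      using sums_unique[OF 2] by (simp add: theta)
    show "(\<Sum>n. (-1) ^ (n + 1) * q ^ ((n + 2) choose 2) / qpoch (q ^ (n + 1)) q (n + 1)) =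
          - q * (\<Sum>n. (-1) ^ n * q powi (- 5 * int n + 21 * int ((n + 1) choose 2)))
          - q ^ 6 * (\<Sum>n. (-1) ^ n * q powi (5 * int n + 21 * int ((n + 1) choose 2)))
          - q ^ 2 * (\<Sum>n. (-1) ^ n * q powi (- 2 * int n + 21 * int ((n + 1) choose 2)))
          - q ^ 4 * (\<Sum>n. (-1) ^ n * q powi (2 * int n + 21 * int ((n + 1) choose 2)))"
      using sums_unique[OF 3] by (simp only: theta distrib)
  qed
qed

end
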